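(* Let $m,c$ be fixed positive integers, and let $T_n$ denote the number of $(c,m)$-colored $B_n$-partitions. For each $n\ge1$ let $r=r(n)$ be the unique positive solution of $r\,(e^{mr}+c)=n$. Then, as $n\to\infty$, \[ T_n=\frac{1}{\sqrt{mr+1}}\exp\Bigl(mnr-n+\frac{n}{mr}+2cr-\frac{1+c}{m}\Bigr)\cdot\Bigl(1+O\Bigl(\frac{\log^{7/2} n}{\sqrt n}\Bigr)\Bigr). \]
   Context: Let $n,m,c$ be positive integers, let $C_1$ be a list of $c$ colors and $C_2$ a list of $m$ colors. A $(c,m)$-colored $B_n$-partition is a set partition $\pi$ of $[n]\cup\{0\}$ together with a coloring of the elements of $[n]$ defined as follows. For $x\in[n]\cup\{0\}$ let $b_x$ be the block of $\pi$ containing $x$. The block $b_0$ is called the zero-block, and every other block is a non-zero-block. Each $x\in[n]$ receives a color according to these rules: if $x=\min b_x$, then $x$ gets the first color of $C_2$; if $x\ne\min b_x$ and $x\in b_0$, then $x$ gets an arbitrary color from $C_1$; if $x\ne \min b_x$ and $x\notin b_0$, then $x$ gets an arbitrary color from $C_2$. Two such objects are equal exactly when they have the same underlying partition and the same coloring. Equivalently, $\sum_{n\ge0}T_n z^n/n!=\exp\bigl((e^{mz}-1)/m+cz\bigr)$ with $T_0=1$. *)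

theory Defs
  imports "HOL-Analysis.Analysis" "HOL-Library.Disjoint_Sets" "HOL-Library.Landau_Symbols"
begin

definition block_of :: "nat set set \<Rightarrow> nat \<Rightarrow> nat set" where
  "block_of P x = (THE b. b \<in> P \<and> x \<in> b)"

text \<open>Colors: the list C1 of c colors is represented by {0..<c}, the list C2 of m colors
  by {0..<m}, with 0 the first color of C2.  A colored B_n-partition is a pair (P, col)
  where P is a set partition of {0..n} and col is a coloring of [n] = {1..n}
  (extensional: undefined outside {1..n}).\<close>
definition colored_B_partitions :: "nat \<Rightarrow> nat \<Rightarrow> nat \<Rightarrow> (nat set set \<times> (nat \<Rightarrow> nat)) set" where
  "colored_B_partitions c m n =
     {(P, col). partition_on {0..n} P \<and> col \<in> extensional {1..n} \<and>
        (\<forall>x\<in>{1..n}.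
           (x = Min (block_of P x) \<longrightarrow> col x = 0) \<and>
           (x \<noteq> Min (block_of P x) \<and> x \<in> block_of P 0 \<longrightarrow> col x < c) \<and>
           (x \<noteq> Min (block_of P x) \<and> x \<notin> block_of P 0 \<longrightarrow> col x < m))}"

definition T :: "nat \<Rightarrow> nat \<Rightarrow> nat \<Rightarrow> nat" where
  "T c m n = card (colored_B_partitions c m n)"

definition rsol :: "nat \<Rightarrow> nat \<Rightarrow> nat \<Rightarrow> real" where
  "rsol c m n = (THE r. r > 0 \<and> r * (exp (real m * r) + real c) = real n)"

end

theory Submission
  imports Defs "HOL-Complex_Analysis.Complex_Analysis" "HOL-Probability.Probability"
    "HOL-Real_Asymp.Real_Asymp"
begin

text \<open>Inserting the largest element into a colored partition mirrors differentiation of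
  \<open>G(z) = exp ((exp (m z) - 1)/m + c z)\<close>, so \<open>T\<^sub>n\<close> is the \<open>n\<close>-th derivative of \<open>G\<close> at 0. Cauchy's formula
  on the circle of radius \<open>r(n)\<close>, the saddle point, writes it as the integral of \<open>exp (F t)\<close> over
  \<open>[-\<pi>, \<pi>]\<close> where \<open>F t = - b t\<^sup>2/2 + O(t\<^sup>3)\<close>. Bounding \<open>|exp (F t) - exp (-b t\<^sup>2/2)|\<close> by its first order
  term costs a relative error \<open>O(r\<^sup>3 exp (-m r/2))\<close>, which is small enough. The same estimate
  for \<open>exp z\<close> at radius \<open>n\<close> yields Stirling's formula with error \<open>O(n\<^sup>-\<^sup>1\<^sup>/\<^sup>2)\<close>.\<close>

section \<open>The exponential generating function\<close>

text \<open>The integral is never cut into a central arc and tails. The inequality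
  \<open>|exp z - exp w| <= exp M * |z - w|\<close>, with \<open>M\<close> bounding both real parts,
  is used on the whole circle, and the cubic remainder integrates against a Gaussian to order
  \<open>K / a^2\<close>. Put \<open>e = exp (m r)\<close>. Then \<open>K\<close> has order
  \<open>r^3 e\<close>, the decay rate \<open>a\<close> order \<open>r e\<close> and the curvature
  \<open>b\<close> order \<open>r^2 e\<close>, so the relative error \<open>sqrt b * K / a^2\<close>
  has order \<open>r^2 exp (- m r/2)\<close>. The looser \<open>r^3 exp (- m r/2)\<close> already
  matches the claimed size: \<open>r (e + c) = n\<close> gives \<open>e ~ n/r\<close> and
  \<open>r ~ ln n / m\<close>, hence the order \<open>ln^(7/2) n / sqrt n\<close>. The exponent in
  the theorem arises after Stirling from \<open>(n/r)^n = (e + c)^n\<close>, where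
  \<open>n ln (e + c) = m n r + c r + O(r/e)\<close>, and from \<open>(e - 1)/m + c r\<close>, where
  \<open>e/m = n/(m r) - c/m\<close>.\<close>

definition admissible :: "nat \<Rightarrow> nat \<Rightarrow> (nat \<Rightarrow> nat) \<Rightarrow> nat set \<Rightarrow> bool" where
  "admissible c m col b \<longleftrightarrow> (\<forall>x\<in>b - {0}. if x = Min b then col x = 0
     else col x < (if 0 \<in> b then c else m))"

lemma block_of_eq: "partition_on A P \<Longrightarrow> b \<in> P \<Longrightarrow> x \<in> b \<Longrightarrow> block_of P x = b"
  unfolding block_of_def by (rule the_equality) (auto dest: partition_onD2 disjointD)

text \<open>The blocks cover \<open>{0..n}\<close>, so the rules can be read block by block. This
  removes \<open>block_of\<close>, and inserting an element then concerns a single block.\<close>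

lemma colored_B_partitions_eq:
  "colored_B_partitions c m n = {(P, col). partition_on {0..n} P \<and> col \<in> extensional {1..n} \<and>
     (\<forall>b\<in>P. admissible c m col b)}"
proof -
  have "(\<forall>x\<in>{1..n}.
           (x = Min (block_of P x) \<longrightarrow> col x = 0) \<and>
           (x \<noteq> Min (block_of P x) \<and> x \<in> block_of P 0 \<longrightarrow> col x < c) \<and>
           (x \<noteq> Min (block_of P x) \<and> x \<notin> block_of P 0 \<longrightarrow> col x < m))
        \<longleftrightarrow> (\<forall>b\<in>P. admissible c m col b)" (is "?L \<longleftrightarrow> ?R")
    if P: "partition_on {0..n} P" for P col
  proof -
    have U: "\<Union>P = {0..n}" using P by (simp add: partition_on_def)
    then obtain b0 where b0: "b0 \<in> P" "0 \<in> b0" by (metis UnionE atLeastAtMost_iff le0)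
    note B0 = block_of_eq[OF P b0]
    have z: "x \<in> b0 \<longleftrightarrow> 0 \<in> b" if "b \<in> P" "x \<in> b" for x b
      using block_of_eq[OF P] b0 that by metis
    have "?L \<longleftrightarrow> (\<forall>b\<in>P. \<forall>x\<in>b - {0}.
           (x = Min (block_of P x) \<longrightarrow> col x = 0) \<and>
           (x \<noteq> Min (block_of P x) \<and> x \<in> block_of P 0 \<longrightarrow> col x < c) \<and>
           (x \<noteq> Min (block_of P x) \<and> x \<notin> block_of P 0 \<longrightarrow> col x < m))"
    proof -
      have "{1..n} = (\<Union>b\<in>P. b - {0})" using U by (auto simp: set_eq_iff Suc_le_eq)
      then show ?thesis by (simp only: ball_UN)
    qed
    also have "\<dots> \<longleftrightarrow> ?R"
      unfolding admissible_def
    proof (intro ball_cong refl)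
      fix b x assume "b \<in> P" "x \<in> b - {0}"
      then have "block_of P x = b" "x \<in> b0 \<longleftrightarrow> 0 \<in> b" using block_of_eq[OF P] z by auto
      then show "((x = Min (block_of P x) \<longrightarrow> col x = 0) \<and>
           (x \<noteq> Min (block_of P x) \<and> x \<in> block_of P 0 \<longrightarrow> col x < c) \<and>
           (x \<noteq> Min (block_of P x) \<and> x \<notin> block_of P 0 \<longrightarrow> col x < m)) =
        (if x = Min b then col x = 0 else col x < (if 0 \<in> b then c else m))"
        unfolding B0 by simp
    qed
    finally show ?thesis .
  qed
  then show ?thesis unfolding colored_B_partitions_def by auto
qed

lemma finite_colored_B_partitions: "finite (colored_B_partitions c m n)"
proof -
  have "colored_B_partitions c m n \<subseteq> {P. partition_on {0..n} P} \<times> (\<Pi>\<^sub>E x\<in>{1..n}. {..c+m})"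
  proof (clarify)
    fix P col assume *: "(P, col) \<in> colored_B_partitions c m n"
    have "col x \<le> c + m" if "x \<in> {1..n}" for x
      using * that unfolding colored_B_partitions_def by fastforce
    then show "P \<in> {P. partition_on {0..n} P} \<and> col \<in> (\<Pi>\<^sub>E x\<in>{1..n}. {..c+m})"
      using * by (auto simp: colored_B_partitions_eq PiE_def)
  qed
  then show ?thesis
    by (rule finite_subset) (intro finite_cartesian_product finitely_many_partition_on finite_PiE; simp)
qed

text \<open>The new element exceeds all of \<open>b\<close>, so it changes no existing minimum and
  is itself a minimum only when \<open>b\<close> is empty. Its color is forced in that case and
  otherwise free in the palette of the block.\<close>

lemma admissible_insert_max:
  assumes "b \<subseteq> {0..n}"
  shows "admissible c m (col(Suc n := k)) (insert (Suc n) b) \<longleftrightarrow>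
    admissible c m col b \<and> (if b = {} then k = 0 else k < (if 0 \<in> b then c else m))"
proof (cases "b = {}")
  case False
  have fin: "finite b" using assms finite_subset by auto
  have "Min b \<in> b" using fin False by simp
  then have "Min b < Suc n" using assms by fastforce
  then have M: "Min (insert (Suc n) b) = Min b" "Suc n \<noteq> Min b" using fin False by simp_all
  have N: "Suc n \<notin> b" using assms by auto
  let ?Q = "\<lambda>x. if x = Min b then (col(Suc n := k)) x = 0
      else (col(Suc n := k)) x < (if 0 \<in> b then c else m)"
  have ins: "insert (Suc n) b - {0} = insert (Suc n) (b - {0})" and z: "0 \<in> insert (Suc n) b \<longleftrightarrow> 0 \<in> b"
    by auto
  have "admissible c m (col(Suc n := k)) (insert (Suc n) b) \<longleftrightarrow> ?Q (Suc n) \<and> (\<forall>x\<in>b - {0}. ?Q x)"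
    unfolding admissible_def M(1) ins z by (rule Set.ball_simps(7))
  also have "?Q (Suc n) \<longleftrightarrow> k < (if 0 \<in> b then c else m)" using M(2) by simp
  also have "(\<forall>x\<in>b - {0}. ?Q x) \<longleftrightarrow> admissible c m col b"
    unfolding admissible_def using N by (intro ball_cong refl) (metis DiffD1 fun_upd_other)
  finally show ?thesis using False by (simp only: conj_commute if_False)
qed (simp add: admissible_def)

lemma admissible_upd: "x \<notin> b \<Longrightarrow> admissible c m (col(x := k)) b \<longleftrightarrow> admissible c m col b"
  unfolding admissible_def by (intro ball_cong refl) (metis DiffD1 fun_upd_other)

section \<open>Insertion of the largest element as a bijection\<close>

text \<open>The ways to insert the new largest element: the pair \<open>({}, 0)\<close> opens a new block, and
  \<open>(b, k)\<close> adds the element to the block \<open>b\<close> with the color \<open>k\<close>. Minima of old blocks do not change.\<close>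
definition insertions :: "nat \<Rightarrow> nat \<Rightarrow> nat set set \<Rightarrow> (nat set \<times> nat) set" where
  "insertions c m P = insert ({}, 0) (Sigma P (\<lambda>b. {..<if 0 \<in> b then c else m}))"

text \<open>No block is empty, so \<open>P - {b}\<close> removes nothing for \<open>b = {}\<close>;
  one formula covers both a new block and an enlarged one.\<close>

definition insert_max ::
  "nat \<Rightarrow> (nat set set \<times> (nat \<Rightarrow> nat)) \<times> (nat set \<times> nat) \<Rightarrow> nat set set \<times> (nat \<Rightarrow> nat)" where
  "insert_max n = (\<lambda>((P, col), (b, k)). (insert (insert (Suc n) b) (P - {b}), col(Suc n := k)))"

text \<open>The inverse deletes \<open>Suc n\<close> from its block and drops the block if nothing
  remains. Injectivity rests on \<open>Suc n\<close> lying in no old block, which makes the enlarged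
  block recognizable in the image.\<close>

lemma bij_betw_insert_max:
  "bij_betw (insert_max n) (SIGMA p:colored_B_partitions c m n. insertions c m (fst p))
     (colored_B_partitions c m (Suc n))"
  unfolding bij_betw_def
proof
  let ?S = "SIGMA p:colored_B_partitions c m n. insertions c m (fst p)"
  show "inj_on (insert_max n) ?S"
  proof (rule inj_onI, clarsimp simp: insert_max_def)
    fix P col b k P' col' b' k'
    assume h: "(P, col) \<in> colored_B_partitions c m n" "(b, k) \<in> insertions c m P"
      "(P', col') \<in> colored_B_partitions c m n" "(b', k') \<in> insertions c m P'"
      and e: "insert (insert (Suc n) b) (P - {b}) = insert (insert (Suc n) b') (P' - {b'})"
      and ec: "col(Suc n := k) = col'(Suc n := k')"
    have U: "\<Union>P = {0..n}" "\<Union>P' = {0..n}" and N': "{} \<notin> P" "{} \<notin> P'"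
      and ex: "col (Suc n) = undefined" "col' (Suc n) = undefined"
      using h(1,3) by (simp_all add: colored_B_partitions_eq partition_on_def extensional_def)
    have N: "Suc n \<notin> \<Union>P" "Suc n \<notin> \<Union>P'" "{} \<notin> P" "{} \<notin> P'"
      unfolding U using N' by auto
    have bP: "b = {} \<or> b \<in> P" "b' = {} \<or> b' \<in> P'" using h by (auto simp: insertions_def)
    have Nin: "insert (Suc n) a \<notin> P" "insert (Suc n) a \<notin> P'" for a
      using N(1,2) by (metis UnionI insertI1)+
    have "insert (Suc n) b \<in> insert (insert (Suc n) b') (P' - {b'})" unfolding e[symmetric] by simp
    then have "insert (Suc n) b = insert (Suc n) b'" using Nin by simp
    moreover have Nb: "Suc n \<notin> b" "Suc n \<notin> b'" using bP N(1,2) by auto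
    ultimately have bb: "b = b'" by (simp add: insert_ident)
    have "P - {b} = P' - {b}" using e Nin unfolding bb by (simp add: insert_ident)
    then have PP: "P = P'"
    proof (cases "b = {}")
      case False
      then have "b \<in> P" "b \<in> P'" using bP unfolding bb by auto
      then show ?thesis using \<open>P - {b} = P' - {b}\<close> by (metis insert_Diff)
    qed (use N(3,4) in simp)
    have "k = k'" using ec by (metis fun_upd_same)
    \<comment> \<open>Both old colorings have the default value \<open>undefined\<close> at
      \<open>Suc n\<close>, so overwriting that entry loses no information.\<close>
    moreover have "col = col'" using ec ex by (metis (no_types) fun_upd_triv fun_upd_upd)
    ultimately show "P = P' \<and> col = col' \<and> b = b' \<and> k = k'" using bb PP by simp
  qed
  show "insert_max n ` ?S = colored_B_partitions c m (Suc n)"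
  proof (intro equalityI subsetI)
    fix q assume "q \<in> insert_max n ` ?S"
    then obtain P col b k where q: "q = (insert (insert (Suc n) b) (P - {b}), col(Suc n := k))"
      and h: "partition_on {0..n} P" "col \<in> extensional {1..n}" "\<forall>b\<in>P. admissible c m col b"
        "(b, k) \<in> insertions c m P"
      by (auto simp: insert_max_def colored_B_partitions_eq)
    have U: "\<Union>P = {0..n}" "{} \<notin> P" "disjoint P" using h by (auto simp: partition_on_def)
    have bP: "b = {} \<and> k = 0 \<or> b \<in> P \<and> k < (if 0 \<in> b then c else m)"
      using h by (auto simp: insertions_def split: if_splits)
    have sub: "b \<subseteq> {0..n}" using bP U by auto
    have Ub: "\<Union>(P - {b}) = {0..n} - b"
      using bP U(3) unfolding U(1)[symmetric] disjoint_def by blast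
    then have dj: "disjnt (insert (Suc n) b) (\<Union>(P - {b}))"
      by (auto simp: disjnt_def)
    from Ub have "partition_on ({0..n} - b) (P - {b})"
      using U by (auto simp: partition_on_def disjoint_def)
    moreover have "{0..Suc n} - insert (Suc n) b = {0..n} - b" by auto
    ultimately have "partition_on {0..Suc n} (insert (insert (Suc n) b) (P - {b}))"
      using sub by (subst partition_on_insert[OF dj]) auto
    moreover have "col(Suc n := k) \<in> extensional {1..Suc n}"
      using h(2) by (auto simp: extensional_def)
    moreover have "admissible c m (col(Suc n := k)) (insert (Suc n) b)"
    proof -
      have "admissible c m col {}" by (simp add: admissible_def)
      then have "admissible c m col b" using bP h(3) by blast
      then show ?thesis using bP U(2) by (subst admissible_insert_max[OF sub]) metis
    qed
    moreover have "admissible c m (col(Suc n := k)) b'" if "b' \<in> P - {b}" for b'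
    proof -
      have "b' \<subseteq> {0..n}" using that U(1) by blast
      then have "Suc n \<notin> b'" by auto
      then show ?thesis using that h(3) by (simp add: admissible_upd)
    qed
    ultimately show "q \<in> colored_B_partitions c m (Suc n)"
      unfolding q colored_B_partitions_eq by auto
  next
    fix q assume "q \<in> colored_B_partitions c m (Suc n)"
    then obtain Q col where q: "q = (Q, col)" and h: "partition_on {0..Suc n} Q"
      "col \<in> extensional {1..Suc n}" "\<forall>b\<in>Q. admissible c m col b"
      by (auto simp: colored_B_partitions_eq)
    have U: "\<Union>Q = {0..Suc n}" "{} \<notin> Q" "disjoint Q" using h by (auto simp: partition_on_def)
    obtain B where B: "B \<in> Q" "Suc n \<in> B" using U(1) by (metis UnionE atLeastAtMost_iff le0 order_refl)
    define b where "b = B - {Suc n}"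
    \<comment> \<open>Subtracting \<open>{{}}\<close> drops the block when \<open>Suc n\<close> was
      alone in it.\<close>
    define P where "P = (Q - {B}) \<union> ({b} - {{}})"
    define col' where "col' = col(Suc n := undefined)"
    have Bb: "B = insert (Suc n) b" "Suc n \<notin> b" using B by (auto simp: b_def)
    have bB: "b \<subseteq> B" by (auto simp: b_def)
    have "B \<subseteq> {0..Suc n}" using U(1) B(1) by blast
    then have sub: "b \<subseteq> {0..n}" by (auto simp: b_def le_Suc_eq)
    have notin: "Suc n \<notin> b'" if "b' \<in> Q - {B}" for b'
      using that B U(3) unfolding disjoint_def by blast
    have UP: "\<Union>(Q - {B}) = {0..Suc n} - B"
      using U(3) B(1) unfolding U(1)[symmetric] disjoint_def by blast
    have bnQ: "b \<notin> Q - {B}"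
    proof
      assume b: "b \<in> Q - {B}"
      then have "b \<inter> B = {}" using disjointD[OF U(3)] B(1) by blast
      then show False using b bB U(2) by (simp add: Int_absorb2)
    qed
    have "partition_on {0..n} P"
    proof (rule partition_onI)
      have "\<Union>({b} - {{}}) = b" by (cases "b = {}") auto
      moreover have "{0..Suc n} - B = {0..n} - b" unfolding Bb(1) by auto
      ultimately have "\<Union>P = ({0..n} - b) \<union> b" unfolding P_def Union_Un_distrib UP by simp
      then show "\<Union>P = {0..n}" using sub by blast
      show "disjnt p q" if "p \<in> P" "q \<in> P" "p \<noteq> q" for p q
      proof -
        have *: "disjnt b a \<and> disjnt a b" if "a \<in> Q - {B}" for a
          using disjointD[OF U(3), of a B] that B(1) bB by (auto simp: disjnt_def)
        show ?thesis
          using that * disjointD[OF U(3), of p q] by (auto simp: P_def disjnt_def)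
      qed
      show "{} \<notin> P" using U P_def by auto
    qed
    moreover have "col' \<in> extensional {1..n}" using h(2) by (auto simp: extensional_def col'_def)
    moreover have adB: "admissible c m col' b \<and> (if b = {} then col (Suc n) = 0 else col (Suc n) < (if 0 \<in> b then c else m))"
    proof -
      have "col = col'(Suc n := col (Suc n))" by (simp add: col'_def)
      then show ?thesis using admissible_insert_max[OF sub, of c m col' "col (Suc n)"] h(3) B Bb by auto
    qed
    moreover have "admissible c m col' b'" if "b' \<in> Q - {B}" for b'
      using notin[OF that] that h(3) by (simp add: admissible_upd col'_def)
    ultimately have "(P, col') \<in> colored_B_partitions c m n"
      by (auto simp: colored_B_partitions_eq P_def)
    moreover have "(b, col (Suc n)) \<in> insertions c m P"
      using adB by (cases "b = {}") (simp_all add: insertions_def P_def)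
    moreover have "q = insert_max n ((P, col'), (b, col (Suc n)))"
    proof -
      have "P - {b} = Q - {B}" using bnQ U(2) by (auto simp: P_def)
      then show ?thesis using Bb B by (auto simp: insert_max_def q col'_def)
    qed
    ultimately show "q \<in> insert_max n ` ?S" by force
  qed
qed

text \<open>The number of insertions depends on the number of blocks, so no recursion for the bare
  count closes; a weight \<open>g\<close> of the block count is carried along. There is one way to
  open a block, \<open>c\<close> ways to join the zero-block and \<open>m\<close> ways for each of
  the other \<open>card - 1\<close> blocks.\<close>

lemma sum_colored_B_partitions_Suc:
  fixes g :: "nat \<Rightarrow> 'a::comm_semiring_1"
  shows "(\<Sum>p\<in>colored_B_partitions c m (Suc n). g (card (fst p))) =
    (\<Sum>p\<in>colored_B_partitions c m n. g (Suc (card (fst p))) +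
       of_nat (c + m * (card (fst p) - 1)) * g (card (fst p)))"
proof -
  have fI: "finite (insertions c m P)" if "finite P" for P
    using that by (auto simp: insertions_def)
  have fP: "finite (fst p)" if "p \<in> colored_B_partitions c m n" for p
    using that finite_elements[of "{0..n}"] by (auto simp: colored_B_partitions_eq)
  have "(\<Sum>p\<in>colored_B_partitions c m (Suc n). g (card (fst p))) =
      (\<Sum>s\<in>(SIGMA p:colored_B_partitions c m n. insertions c m (fst p)). g (card (fst (insert_max n s))))"
    by (rule sum.reindex_bij_betw[OF bij_betw_insert_max, symmetric])
  also have "\<dots> = (\<Sum>p\<in>colored_B_partitions c m n. \<Sum>i\<in>insertions c m (fst p). g (card (fst (insert_max n (p, i)))))"
    by (subst sum.Sigma) (auto simp: finite_colored_B_partitions fI fP split_def)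
  also have "\<dots> = (\<Sum>p\<in>colored_B_partitions c m n. g (Suc (card (fst p))) +
       of_nat (c + m * (card (fst p) - 1)) * g (card (fst p)))"
  proof (rule sum.cong[OF refl])
    fix p assume p: "p \<in> colored_B_partitions c m n"
    obtain P col where pP: "p = (P, col)" by (cases p)
    have U: "\<Union>P = {0..n}" "{} \<notin> P" "disjoint P" and finP: "finite P"
      using p fP pP by (auto simp: colored_B_partitions_eq partition_on_def)
    obtain b0 where b0: "b0 \<in> P" "0 \<in> b0" using U by (metis UnionE atLeastAtMost_iff le0)
    have nz: "0 \<notin> b" if "b \<in> P - {b0}" for b using that b0 U by (auto simp: disjoint_def)
    have "insert (Suc n) b \<notin> P" for b using U(1) by (metis UnionI atLeastAtMost_iff insertI1 not_less_eq_eq order_refl)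
    then have cN: "card (insert (insert (Suc n) b) (P - {b})) = (if b \<in> P then card P else Suc (card P))" for b
      using finP card_Suc_Diff1[OF finP] by (auto simp del: card_Diff_insert card_Diff_singleton)
    have "(\<Sum>i\<in>insertions c m P. g (card (fst (insert_max n (p, i))))) =
        g (Suc (card P)) + (\<Sum>i\<in>Sigma P (\<lambda>b. {..<if 0 \<in> b then c else m}). g (card (fst (insert_max n (p, i)))))"
      unfolding insertions_def using U finP cN[of "{}"]
      by (subst sum.insert) (auto simp: insert_max_def pP)
    also have "(\<Sum>i\<in>Sigma P (\<lambda>b. {..<if 0 \<in> b then c else m}). g (card (fst (insert_max n (p, i))))) =
        (\<Sum>i\<in>Sigma P (\<lambda>b. {..<if 0 \<in> b then c else m}). g (card P))"
      by (rule sum.cong) (auto simp: insert_max_def pP cN)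
    also have "\<dots> = of_nat (card (Sigma P (\<lambda>b. {..<if 0 \<in> b then c else m}))) * g (card P)"
      by simp
    also have "card (Sigma P (\<lambda>b. {..<if 0 \<in> b then c else m})) = (\<Sum>b\<in>P. if 0 \<in> b then c else m)"
      using finP by (subst card_SigmaI) auto
    also have "\<dots> = c + (\<Sum>b\<in>P - {b0}. if 0 \<in> b then c else m)"
      using finP b0 by (subst sum.remove[of _ b0]) auto
    also have "(\<Sum>b\<in>P - {b0}. if 0 \<in> b then c else m) = (\<Sum>b\<in>P - {b0}. m)"
      by (rule sum.cong) (use nz in simp_all)
    also have "\<dots> = m * (card P - 1)" using b0 finP by (simp add: mult.commute)
    finally show "(\<Sum>i\<in>insertions c m (fst p). g (card (fst (insert_max n (p, i))))) =
        g (Suc (card (fst p))) + of_nat (c + m * (card (fst p) - 1)) * g (card (fst p))"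
      by (simp add: pP)
  qed
  finally show ?thesis .
qed

lemma colored_B_partitions_0: "colored_B_partitions c m 0 = {({{0}}, \<lambda>_. undefined)}"
proof -
  have "partition_on {0} P \<longleftrightarrow> P = {{0::nat}}" for P
  proof
    assume *: "partition_on {0} P"
    have "b = {0}" if "b \<in> P" for b
      using partition_onD1[OF *] partition_onD3[OF *] that by (metis Sup_upper subset_singletonD)
    moreover have "P \<noteq> {}" using * by (auto simp: partition_on_def)
    ultimately show "P = {{0}}" by blast
  qed (auto simp: partition_on_def)
  then show ?thesis by (auto simp: colored_B_partitions_eq admissible_def)
qed

lemma card_pos_colored_B_partitions: "p \<in> colored_B_partitions c m n \<Longrightarrow> card (fst p) > 0"
  using finite_elements[of "{0..n}" "fst p"]
  by (auto simp: colored_B_partitions_eq card_gt_0_iff partition_on_def)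

section \<open>Derivatives of the generating function\<close>

definition egf :: "nat \<Rightarrow> nat \<Rightarrow> complex \<Rightarrow> complex" where
  "egf c m z = exp ((exp (of_nat m * z) - 1) / of_nat m + of_nat c * z)"

lemma has_field_derivative_egf:
  "m > 0 \<Longrightarrow> (egf c m has_field_derivative (exp (of_nat m * z) + of_nat c) * egf c m z) (at z)"
  unfolding egf_def by (auto intro!: derivative_eq_intros simp: field_simps)

text \<open>With \<open>e = exp (m z)\<close>, a partition with \<open>k\<close> non-zero blocks has
  weight \<open>e^k\<close>. Differentiating the weight gives \<open>m k e^k\<close>, a new element
  joining a non-zero block; in the factor \<open>e + c\<close> coming from \<open>egf\<close>,
  \<open>e\<close> opens a block and \<open>c\<close> counts the colors in the zero-block.\<close>

lemma higher_deriv_egf: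
  assumes "m > 0"
  shows "(deriv ^^ n) (egf c m) =
    (\<lambda>z. (\<Sum>p\<in>colored_B_partitions c m n. exp (of_nat m * z) ^ (card (fst p) - 1)) * egf c m z)"
proof (induction n)
  case 0
  then show ?case by (simp add: colored_B_partitions_0)
next
  case (Suc n)
  show ?case
  proof
    fix z :: complex
    let ?e = "exp (of_nat m * z)" and ?C = "colored_B_partitions c m n"
    have d: "((\<lambda>z. exp (of_nat m * z) ^ k) has_field_derivative of_nat k * ?e ^ (k - 1) * (?e * of_nat m)) (at z)" for k
      by (auto intro!: derivative_eq_intros)
    have D: "((\<lambda>z. (\<Sum>p\<in>?C. exp (of_nat m * z) ^ (card (fst p) - 1)) * egf c m z) has_field_derivative
       (\<Sum>p\<in>?C. of_nat (card (fst p) - 1) * ?e ^ (card (fst p) - 1 - 1) * (?e * of_nat m)) * egf c m z +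
       (?e + of_nat c) * egf c m z * (\<Sum>p\<in>?C. ?e ^ (card (fst p) - 1))) (at z)"
      by (intro DERIV_mult DERIV_sum has_field_derivative_egf assms d)
    \<comment> \<open>At \<open>k = 0\<close> the truncated exponent \<open>k - 1\<close> is
      harmless, since the factor \<open>of_nat k\<close> vanishes.\<close>
    have t: "of_nat k * ?e ^ (k - 1) * (?e * of_nat m) = of_nat (m * k) * ?e ^ k" for k
      by (cases k) (auto simp: field_simps)
    have "(deriv ^^ Suc n) (egf c m) z =
       (\<Sum>p\<in>?C. of_nat (m * (card (fst p) - 1)) * ?e ^ (card (fst p) - 1)) * egf c m z +
       (?e + of_nat c) * egf c m z * (\<Sum>p\<in>?C. ?e ^ (card (fst p) - 1))"
      using DERIV_imp_deriv[OF D] unfolding t by (simp add: Suc.IH)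
    also have "\<dots> = (\<Sum>p\<in>?C. ?e ^ (card (fst p)) + of_nat (c + m * (card (fst p) - 1)) * ?e ^ (card (fst p) - 1)) * egf c m z"
    proof -
      have "(\<Sum>p\<in>?C. ?e ^ (card (fst p)) + of_nat (c + m * (card (fst p) - 1)) * ?e ^ (card (fst p) - 1)) =
        (\<Sum>p\<in>?C. of_nat (m * (card (fst p) - 1)) * ?e ^ (card (fst p) - 1) + (?e + of_nat c) * ?e ^ (card (fst p) - 1))"
      proof (rule sum.cong[OF refl])
        fix p assume "p \<in> ?C"
        then obtain k where "card (fst p) = Suc k"
          using card_pos_colored_B_partitions gr0_implies_Suc by blast
        then show "?e ^ (card (fst p)) + of_nat (c + m * (card (fst p) - 1)) * ?e ^ (card (fst p) - 1) =
          of_nat (m * (card (fst p) - 1)) * ?e ^ (card (fst p) - 1) + (?e + of_nat c) * ?e ^ (card (fst p) - 1)"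
          by (simp add: algebra_simps)
      qed
      then show ?thesis by (simp add: sum.distrib sum_distrib_left algebra_simps)
    qed
    also have "(\<Sum>p\<in>?C. ?e ^ (card (fst p)) + of_nat (c + m * (card (fst p) - 1)) * ?e ^ (card (fst p) - 1)) =
       (\<Sum>p\<in>colored_B_partitions c m (Suc n). ?e ^ (card (fst p) - 1))"
      using sum_colored_B_partitions_Suc[of "\<lambda>k. ?e ^ (k - 1)" c m n] by simp
    finally show "(deriv ^^ Suc n) (egf c m) z =
      (\<Sum>p\<in>colored_B_partitions c m (Suc n). ?e ^ (card (fst p) - 1)) * egf c m z" .
  qed
qed

text \<open>At 0 all weights and \<open>egf\<close> itself equal 1, so the sum is a count.\<close>

lemma higher_deriv_egf_0: "m > 0 \<Longrightarrow> (deriv ^^ n) (egf c m) 0 = of_nat (T c m n)"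
  by (subst higher_deriv_egf) (auto simp: T_def egf_def)

section \<open>The saddle point estimate\<close>

text \<open>Cutting the cosine series at fourth order leaves \<open>x^2/2 - x^4/24\<close>, and
  \<open>x^2 <= 10\<close> on the interval makes this at least
  \<open>(1/2 - 10/24) x^2\<close>.\<close>

lemma one_minus_cos_ge:
  fixes x :: real
  assumes "\<bar>x\<bar> \<le> pi"
  shows "x\<^sup>2 / 12 \<le> 1 - cos x"
proof -
  obtain t where t: "cos x = (\<Sum>m<4. cos_coeff m * x ^ m) + (cos (t + 1/2 * real 4 * pi) / fact 4) * x ^ 4"
    using Maclaurin_cos_expansion[of x 4] by blast
  have "cos x = 1 - x\<^sup>2 / 2 + cos (t + 2 * pi) / 24 * x ^ 4"
  proof -
    have "\<not> Suc (Suc 0) dvd Suc (Suc (Suc 0))" by (simp add: numeral_2_eq_2[symmetric])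
    then show ?thesis using t by (simp add: eval_nat_numeral cos_coeff_def fact_numeral)
  qed
  moreover have "cos (t + 2 * pi) / 24 * x ^ 4 \<le> 1 / 24 * x ^ 4"
    by (intro mult_right_mono) auto
  ultimately have "cos x \<le> 1 - x\<^sup>2 / 2 + x ^ 4 / 24" by simp
  moreover have "x\<^sup>2 \<le> 10"
  proof -
    have "\<bar>x\<bar> \<le> 3.15" using assms pi_approx by simp
    then have "\<bar>x\<bar>\<^sup>2 \<le> 3.15\<^sup>2" by (intro power_mono) auto
    then show ?thesis by (simp add: power2_eq_square)
  qed
  then have "x\<^sup>2 * x\<^sup>2 \<le> 10 * x\<^sup>2" by (intro mult_right_mono) auto
  then have "x ^ 4 \<le> 10 * x\<^sup>2" by (simp add: power2_eq_square eval_nat_numeral)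
  ultimately show ?thesis by simp
qed

text \<open>Mean value inequality on a half-plane, which is convex and where the derivative of
  \<open>exp\<close> has norm at most \<open>exp M\<close>.\<close>

lemma norm_exp_diff_le:
  fixes z w :: complex
  assumes "Re z \<le> M" "Re w \<le> M"
  shows "norm (exp z - exp w) \<le> exp M * norm (z - w)"
proof (rule field_differentiable_bound[where S = "{u. Re u \<le> M}"])
  show "convex {u. Re u \<le> M}" by (rule convex_halfspace_Re_le)
qed (use assms in \<open>auto intro!: derivative_eq_intros\<close>)

text \<open>The half-line moment 1/2 is doubled by symmetry and rescaled by \<open>sqrt a\<close>;
  three powers of \<open>sqrt a\<close> come from the integrand and one from the measure.\<close>

lemma gaussian_abs_moment_3:
  fixes a :: real
  assumes "a > 0"
  shows "has_bochner_integral lborel (\<lambda>x. \<bar>x\<bar> ^ 3 * exp (- (a * x\<^sup>2))) (1 / a\<^sup>2)"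
proof -
  have "has_bochner_integral lborel (\<lambda>x::real. exp (- x\<^sup>2) * \<bar>x\<bar> ^ 3) (2 *\<^sub>R (1 / 2))"
  proof (rule has_bochner_integral_even_function)
    have "(\<lambda>x::real. indicator {0..} x *\<^sub>R (exp (- x\<^sup>2) * \<bar>x\<bar> ^ 3)) =
        (\<lambda>x. indicator {0..} x *\<^sub>R (exp (- x\<^sup>2) * x ^ (2 * 1 + 1)))"
      by (auto simp: fun_eq_iff indicator_def)
    then show "has_bochner_integral lborel
        (\<lambda>x::real. indicator {0..} x *\<^sub>R (exp (- x\<^sup>2) * \<bar>x\<bar> ^ 3)) (1 / 2)"
      using gaussian_moment_odd_pos[of 1] by simp
  qed simp
  then have "has_bochner_integral lborel
      (\<lambda>x. exp (- (0 + sqrt a * x)\<^sup>2) * \<bar>0 + sqrt a * x\<bar> ^ 3) (1 /\<^sub>R \<bar>sqrt a\<bar>)"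
    using assms by (subst (asm) lborel_has_bochner_integral_real_affine_iff[where c = "sqrt a" and t = 0]) auto
  then have "has_bochner_integral lborel
      (\<lambda>x. (exp (- (0 + sqrt a * x)\<^sup>2) * \<bar>0 + sqrt a * x\<bar> ^ 3) * (1 / sqrt a ^ 3)) ((1 /\<^sub>R \<bar>sqrt a\<bar>) * (1 / sqrt a ^ 3))"
    by (rule has_bochner_integral_mult_left)
  moreover have "(1 /\<^sub>R \<bar>sqrt a\<bar>) * (1 / sqrt a ^ 3) = 1 / a\<^sup>2"
  proof -
    have "sqrt a * sqrt a ^ 3 = (sqrt a ^ 2) ^ 2" by algebra
    then have "sqrt a * sqrt a ^ 3 = a\<^sup>2" using assms by simp
    then show ?thesis using assms by (simp add: divide_simps)
  qed
  moreover have "(exp (- (0 + sqrt a * x)\<^sup>2) * \<bar>0 + sqrt a * x\<bar> ^ 3) * (1 / sqrt a ^ 3)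
     = \<bar>x\<bar> ^ 3 * exp (- (a * x\<^sup>2))" for x
    using assms by (simp add: power_mult_distrib abs_mult)
  ultimately show ?thesis by simp
qed

lemma gaussian_integral:
  fixes b :: real
  assumes "b > 0"
  shows "has_bochner_integral lborel (\<lambda>x. exp (- (b * x\<^sup>2 / 2))) (sqrt (2 * pi / b))"
proof -
  have "has_bochner_integral lborel (\<lambda>x::real. exp (- x\<^sup>2)) (2 *\<^sub>R (sqrt pi / 2))"
    by (rule has_bochner_integral_even_function[OF gaussian_moment_0]) simp
  then have "has_bochner_integral lborel
      (\<lambda>x. exp (- (0 + sqrt (b / 2) * x)\<^sup>2)) (sqrt pi /\<^sub>R \<bar>sqrt (b / 2)\<bar>)"
    using assms by (subst (asm) lborel_has_bochner_integral_real_affine_iff[where c = "sqrt (b / 2)" and t = 0]) auto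
  moreover have "sqrt pi /\<^sub>R \<bar>sqrt (b / 2)\<bar> = sqrt (2 * pi / b)"
    using assms by (simp add: real_sqrt_divide real_sqrt_mult field_simps)
  ultimately show ?thesis using assms by (simp add: power_mult_distrib)
qed

text \<open>The cubic bound controls the distance of \<open>F t\<close> from the Gaussian exponent,
  the decay bound the size of both exponentials; \<open>a \<le> b / 2\<close> makes it serve for the
  Gaussian too. \<open>\<epsilon>\<close> absorbs the part of the circle where
  \<open>Re (F t)\<close> no longer falls quadratically.\<close>

lemma saddle_point_estimate:
  fixes F :: "real \<Rightarrow> complex"
  assumes cont: "continuous_on {-pi..pi} F" and a: "0 < a" "a \<le> b / 2" and "K \<ge> 0" "\<epsilon> \<ge> 0"
    and cubic: "\<And>t. \<bar>t\<bar> \<le> pi \<Longrightarrow> norm (F t + of_real (b * t\<^sup>2 / 2)) \<le> K * \<bar>t\<bar> ^ 3"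
    and decay: "\<And>t. \<bar>t\<bar> \<le> pi \<Longrightarrow> exp (Re (F t)) \<le> exp (- (a * t\<^sup>2)) + \<epsilon>"
  shows "norm (integral {-pi..pi} (\<lambda>t. exp (F t)) - of_real (sqrt (2 * pi / b)))
     \<le> (K + 1) / a\<^sup>2 + 2 * pi ^ 4 * K * \<epsilon>"
proof -
  define G where "G t = exp (complex_of_real (- (b * t\<^sup>2 / 2)))" for t :: real
  define H where "H t = indicator {-pi..pi} t *\<^sub>R exp (F t)" for t :: real
  \<comment> \<open>The first summand integrates to \<open>(K + 1) / a^2\<close> by the third
    moment. In the second, \<open>|t|^3 <= pi^3\<close> and the length \<open>2 * pi\<close> combine
    to \<open>2 * pi ^ 4\<close>.\<close>
  define B where "B t = (K + 1) * (\<bar>t\<bar> ^ 3 * exp (- (a * t\<^sup>2))) + K * pi ^ 3 * \<epsilon> * indicator {-pi..pi} t" for t :: real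
  have b: "b > 0" using a by simp
  have G: "has_bochner_integral lborel G (of_real (sqrt (2 * pi / b)))"
    unfolding G_def exp_of_real by (intro has_bochner_integral_of_real gaussian_integral b)
  have cexp: "continuous_on {-pi..pi} (\<lambda>t. exp (F t))" by (intro continuous_intros cont)
  have "set_integrable lborel {-pi..pi} (\<lambda>t. exp (F t))"
    by (intro borel_integrable_atLeastAtMost' cexp)
  then have H: "has_bochner_integral lborel H (integral {-pi..pi} (\<lambda>t. exp (F t)))"
    unfolding H_def has_bochner_integral_iff
    using set_borel_integral_eq_integral(2)[of "{-pi..pi}" "\<lambda>t. exp (F t)"]
    by (simp add: set_integrable_def set_lebesgue_integral_def)
  have "has_bochner_integral lborel (indicator {-pi..pi} :: real \<Rightarrow> real) (measure lborel {-pi..pi})"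
    by (rule has_bochner_integral_real_indicator) auto
  then have I: "has_bochner_integral lborel (indicator {-pi..pi} :: real \<Rightarrow> real) (2 * pi)" by simp
  have B: "has_bochner_integral lborel B ((K + 1) * (1 / a\<^sup>2) + K * pi ^ 3 * \<epsilon> * (2 * pi))"
    unfolding B_def using a
    by (intro has_bochner_integral_add has_bochner_integral_mult_right gaussian_abs_moment_3 I)
  have HG: "norm (H t - G t) \<le> B t" for t
  proof (cases "\<bar>t\<bar> \<le> pi")
    case True
    \<comment> \<open>\<open>exp M\<close> is then exactly the decay bound, so \<open>M\<close>
      dominates both real parts.\<close>
    define M where "M = ln (exp (- (a * t\<^sup>2)) + \<epsilon>)"
    have pos: "exp (- (a * t\<^sup>2)) + \<epsilon> > 0" using \<open>\<epsilon> \<ge> 0\<close> by (simp add: add_pos_nonneg)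
    then have eM: "exp M = exp (- (a * t\<^sup>2)) + \<epsilon>" by (simp add: M_def)
    have "Re (F t) \<le> M" using decay[OF True] eM by (metis exp_le_cancel_iff)
    moreover have "Re (complex_of_real (- (b * t\<^sup>2 / 2))) \<le> M"
    proof -
      have "a * t\<^sup>2 \<le> b / 2 * t\<^sup>2" using a by (intro mult_right_mono) auto
      then have "exp (- (b * t\<^sup>2 / 2)) \<le> exp (- (a * t\<^sup>2))" by simp
      also have "\<dots> \<le> exp M" using eM \<open>\<epsilon> \<ge> 0\<close> by simp
      finally show ?thesis by simp
    qed
    ultimately have "norm (exp (F t) - G t) \<le> exp M * norm (F t - complex_of_real (- (b * t\<^sup>2 / 2)))"
      unfolding G_def by (rule norm_exp_diff_le)
    also have "\<dots> = exp M * norm (F t + of_real (b * t\<^sup>2 / 2))" by simp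
    also have "\<dots> \<le> exp M * (K * \<bar>t\<bar> ^ 3)" using cubic[OF True] by (intro mult_left_mono) auto
    also have "\<dots> = K * (\<bar>t\<bar> ^ 3 * exp (- (a * t\<^sup>2))) + K * \<bar>t\<bar> ^ 3 * \<epsilon>"
      unfolding eM by (simp add: algebra_simps)
    also have "\<dots> \<le> (K + 1) * (\<bar>t\<bar> ^ 3 * exp (- (a * t\<^sup>2))) + K * pi ^ 3 * \<epsilon>"
      using True \<open>K \<ge> 0\<close> \<open>\<epsilon> \<ge> 0\<close>
      by (intro add_mono mult_right_mono mult_left_mono power_mono) auto
    finally show ?thesis using True by (auto simp: H_def B_def indicator_def)
  next
    case False
    \<comment> \<open>Beyond the interval only the Gaussian remains, and \<open>|t|^3 >= 1\<close>
      lets the cubic majorant absorb it. This is the source of the 1 in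
      \<open>K + 1\<close>.\<close>
    then have t: "\<bar>t\<bar> \<ge> 1" using pi_ge_two by linarith
    have "a * t\<^sup>2 \<le> b / 2 * t\<^sup>2" using a by (intro mult_right_mono) auto
    then have "exp (- (b * t\<^sup>2 / 2)) \<le> exp (- (a * t\<^sup>2))" by simp
    also have "\<dots> \<le> (K + 1) * (\<bar>t\<bar> ^ 3 * exp (- (a * t\<^sup>2)))"
    proof -
      have "1 * 1 \<le> (K + 1) * \<bar>t\<bar> ^ 3" using \<open>K \<ge> 0\<close> t by (intro mult_mono one_le_power) auto
      then have "1 * exp (- (a * t\<^sup>2)) \<le> ((K + 1) * \<bar>t\<bar> ^ 3) * exp (- (a * t\<^sup>2))"
        by (intro mult_right_mono) auto
      then show ?thesis by (simp add: mult.assoc)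
    qed
    finally show ?thesis using False by (auto simp: H_def B_def G_def indicator_def)
  qed
  have HGi: "has_bochner_integral lborel (\<lambda>t. H t - G t) (integral {-pi..pi} (\<lambda>t. exp (F t)) - of_real (sqrt (2 * pi / b)))"
    by (intro has_bochner_integral_diff H G)
  have "norm (integral {-pi..pi} (\<lambda>t. exp (F t)) - of_real (sqrt (2 * pi / b))) = norm (\<integral>t. H t - G t \<partial>lborel)"
    using HGi by (simp add: has_bochner_integral_iff)
  also have "\<dots> \<le> (\<integral>t. B t \<partial>lborel)"
    using HGi B HG by (intro Bochner_Integration.integral_norm_bound_integral) (auto simp: has_bochner_integral_iff)
  also have "\<dots> = (K + 1) / a\<^sup>2 + 2 * pi ^ 4 * K * \<epsilon>"
    using B by (simp add: has_bochner_integral_iff eval_nat_numeral)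
  finally show ?thesis .
qed

section \<open>Cauchy's formula over a symmetric interval\<close>

lemma has_integral_circle_coefficient:
  fixes G :: "complex \<Rightarrow> complex"
  assumes hol: "G holomorphic_on UNIV" and r: "r > 0"
  shows "((\<lambda>t. G (of_real r * cis t) * cis (- (real n * t))) has_integral
     of_real (2 * pi * r ^ n) * (deriv ^^ n) G 0 / fact n) {-pi..pi}"
proof -
  \<comment> \<open>The circle is parametrized over \<open>[0, 2 pi]\<close>. Shifting by
    \<open>pi\<close> turns \<open>cis t\<close> into \<open>- cis t\<close>, and passing to
    \<open>G (- w)\<close> undoes the sign.\<close>
  have hol': "(\<lambda>w. G (- 1 * w)) holomorphic_on S" for S
    using holomorphic_on_compose_gen[of "\<lambda>w. - 1 * w" S G UNIV] hol
    by (simp add: o_def holomorphic_on_minus holomorphic_on_id[unfolded id_def] holomorphic_on_ident)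
  have "((\<lambda>u. G (- 1 * u) / (u - 0) ^ Suc n) has_contour_integral
      (2 * pi * \<i>) / fact n * (deriv ^^ n) (\<lambda>w. G (- 1 * w)) 0) (circlepath 0 r)"
    using r by (intro Cauchy_has_contour_integral_higher_derivative_circlepath hol'
        holomorphic_on_imp_continuous_on) auto
  also have "(deriv ^^ n) (\<lambda>w. G (- 1 * w)) 0 = (- 1) ^ n * (deriv ^^ n) G 0"
    using higher_deriv_compose_linear[OF hol, of UNIV 0 "-1" n] by simp
  finally have "((\<lambda>t. G (- 1 * (0 + r * cis t)) / (0 + r * cis t - 0) ^ Suc n * r * \<i> * cis t) has_integral
      (2 * pi * \<i>) / fact n * ((- 1) ^ n * (deriv ^^ n) G 0)) {0..2 * pi}"
    unfolding circlepath_def by (subst (asm) has_contour_integral_part_circlepath_iff) auto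
  from has_integral_shift_real_ivl[OF this, of pi]
  have "((\<lambda>t. G (- 1 * (0 + r * cis (t + pi))) / (0 + r * cis (t + pi) - 0) ^ Suc n * r * \<i> * cis (t + pi)) has_integral
      (2 * pi * \<i>) / fact n * ((- 1) ^ n * (deriv ^^ n) G 0)) {-pi..pi}" by simp
  \<comment> \<open>The factor clears \<open>r^n\<close> and \<open>\<i>\<close>; its
    \<open>(- 1)^n\<close> cancels the signs left by the reflection on both sides.\<close>
  from has_integral_mult_left[OF this, of "of_real (r ^ n) * (- 1) ^ n / \<i>"]
  have *: "((\<lambda>t. G (- 1 * (0 + r * cis (t + pi))) / (0 + r * cis (t + pi) - 0) ^ Suc n * r * \<i> * cis (t + pi)
       * (of_real (r ^ n) * (- 1) ^ n / \<i>)) has_integral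
      (2 * pi * \<i>) / fact n * ((- 1) ^ n * (deriv ^^ n) G 0) * (of_real (r ^ n) * (- 1) ^ n / \<i>)) {-pi..pi}" .
  have m1: "(- 1) ^ n * (- 1) ^ n = (1::complex)" by (simp flip: power_mult_distrib)
  have "cis (t + pi) = - cis t" for t by (simp add: cis_mult[symmetric])
  then have "G (- 1 * (0 + r * cis (t + pi))) / (0 + r * cis (t + pi) - 0) ^ Suc n * r * \<i> * cis (t + pi)
       * (of_real (r ^ n) * (- 1) ^ n / \<i>) = G (of_real r * cis t) * cis (- (real n * t))" for t
  proof -
    have "(- (of_real r * cis t)) ^ Suc n = - ((- 1) ^ n * of_real r ^ n * cis t ^ n * of_real r * cis t)"
      by (subst power_minus) (simp add: power_mult_distrib)
    moreover have "cis (- (real n * t)) = inverse (cis t ^ n)"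
      by (metis Complex.DeMoivre cis_inverse)
    ultimately show ?thesis
      using r m1 \<open>cis (t + pi) = - cis t\<close> by (simp add: divide_simps)
  qed
  moreover have "(2 * pi * \<i>) / fact n * ((- 1) ^ n * (deriv ^^ n) G 0) * (of_real (r ^ n) * (- 1) ^ n / \<i>)
     = of_real (2 * pi * r ^ n) * (deriv ^^ n) G 0 / fact n"
  proof -
    have "A * \<i> / f * (s * D) * (R * s / \<i>) = s * s * (A * R * D / f)" for A f s D R :: complex
      by (simp add: field_simps)
    from this[of "2 * pi" "fact n" "(- 1) ^ n" "(deriv ^^ n) G 0" "of_real (r ^ n)"] show ?thesis
      unfolding m1 by (simp add: mult.assoc)
  qed
  ultimately show ?thesis using * by simp
qed

text \<open>Second order Taylor formula in the angle. The equation for \<open>n\<close> is the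
  saddle point equation: it kills the linear term, and \<open>- b\<close> is the second derivative
  at 0. The parameter \<open>A\<close> covers two uses: \<open>1 / m\<close> for \<open>egf\<close>,
  and 0 with \<open>c = 1\<close> for the plain exponential.\<close>

lemma exponential_cubic_bound:
  fixes A m c r n t :: real
  assumes nn: "A \<ge> 0" "m \<ge> 0" "c \<ge> 0" "r \<ge> 0" and n: "n = r * (A * m * exp (m * r) + c)"
  defines "z \<equiv> of_real r * cis t"
  defines "b \<equiv> n + A * m\<^sup>2 * r\<^sup>2 * exp (m * r)"
  defines "K \<equiv> A * exp (m * r) * (m * r + 3 * (m * r)\<^sup>2 + (m * r) ^ 3) + c * r"
  shows "norm (of_real A * (exp (of_real m * z) - of_real (exp (m * r))) + of_real c * (z - of_real r)
      - \<i> * of_real (n * t) + of_real (b * t\<^sup>2 / 2)) \<le> K / 2 * \<bar>t\<bar> ^ 3"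
proof -
  define E where "E x = of_real r * exp (\<i> * x)" for x :: complex
  \<comment> \<open>For \<open>k <= 3\<close>, \<open>f k\<close> is the k-th derivative of
    \<open>f 0\<close>. With \<open>u = m * E x\<close>, differentiation in \<open>x\<close> acts as
    \<open>\<i> * u * d/du\<close>, and \<open>(u d/du)^3 exp u = (u + 3 u^2 + u^3) exp u\<close>
    explains the coefficients 1, 3, 1.\<close>
  define f where "f k x = (if k = 0 then of_real A * (exp (of_real m * E x) - of_real (exp (m * r))) + of_real c * (E x - of_real r) - \<i> * of_real n * x
     else if k = 1 then \<i> * (of_real A * (of_real m * E x) * exp (of_real m * E x) + of_real c * E x - of_real n)
     else if k = 2 then - (of_real A * (of_real m * E x + (of_real m * E x)\<^sup>2) * exp (of_real m * E x) + of_real c * E x)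
     else - \<i> * (of_real A * exp (of_real m * E x) * (of_real m * E x + 3 * (of_real m * E x)\<^sup>2 + (of_real m * E x) ^ 3) + of_real c * E x))"
    for k :: nat and x :: complex
  have dE: "(E has_field_derivative \<i> * E x) (at x within S)" for x S
    unfolding E_def by (auto intro!: derivative_eq_intros)
  have ii: "\<i> * (\<i> * w) = - w" for w by (simp flip: mult.assoc)
  have d: "(f k has_field_derivative f (Suc k) x) (at x within \<real>)" if "k \<le> 2" for k x
  proof -
    have "k = 0 \<or> k = 1 \<or> k = 2" using that by arith
    then consider "k = 0" | "k = 1" | "k = 2" by blast
    then show ?thesis
    proof cases
      case 1
      have "f k = (\<lambda>x. of_real A * (exp (of_real m * E x) - of_real (exp (m * r))) + of_real c * (E x - of_real r) - \<i> * of_real n * x)"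
        by (simp add: f_def 1 fun_eq_iff)
      then show ?thesis
        by (auto simp: f_def 1 algebra_simps intro!: derivative_eq_intros dE)
    next
      case 2
      have "f k = (\<lambda>x. \<i> * (of_real A * (of_real m * E x) * exp (of_real m * E x) + of_real c * E x - of_real n))"
        by (simp add: f_def 2 fun_eq_iff)
      then show ?thesis
        by (auto simp: f_def 2 algebra_simps power2_eq_square ii intro!: derivative_eq_intros dE)
    next
      case 3
      have "f k = (\<lambda>x. - (of_real A * (of_real m * E x + (of_real m * E x)\<^sup>2) * exp (of_real m * E x) + of_real c * E x))"
        by (simp add: f_def 3 fun_eq_iff)
      then show ?thesis
        by (auto simp: f_def 3 algebra_simps power2_eq_square power3_eq_cube ii intro!: derivative_eq_intros dE)
    qed
  qed
  \<comment> \<open>On the real axis \<open>|E x| = r\<close>. The bound need not hold off it, so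
    the Taylor formula is applied over \<open>\<real>\<close>.\<close>
  have B: "norm (f (Suc 2) x) \<le> K" if "x \<in> \<real>" for x
  proof -
    obtain s where s: "x = of_real s" using \<open>x \<in> \<real>\<close> by (rule Reals_cases)
    have nE: "norm (E x) = r" using nn by (simp add: E_def s norm_mult)
    then have nm: "norm (of_real m * E x) = m * r" using nn by (simp add: norm_mult)
    have "Re (E x) \<le> r" using complex_Re_le_cmod[of "E x"] nE by simp
    then have ne: "norm (exp (of_real m * E x)) \<le> exp (m * r)" using nn by (simp add: mult_left_mono)
    have "norm (of_real m * E x + 3 * (of_real m * E x)\<^sup>2 + (of_real m * E x) ^ 3)
       \<le> norm (of_real m * E x) + norm (3 * (of_real m * E x)\<^sup>2) + norm ((of_real m * E x) ^ 3)"
      by (intro order.trans[OF norm_triangle_ineq] add_mono order.refl norm_triangle_ineq)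
    also have "\<dots> = m * r + 3 * (m * r)\<^sup>2 + (m * r) ^ 3" using nm by (simp add: norm_mult norm_power)
    finally have p: "norm (of_real m * E x + 3 * (of_real m * E x)\<^sup>2 + (of_real m * E x) ^ 3) \<le> m * r + 3 * (m * r)\<^sup>2 + (m * r) ^ 3" .
    have "norm (f (Suc 2) x) = norm (of_real A * exp (of_real m * E x) * (of_real m * E x + 3 * (of_real m * E x)\<^sup>2 + (of_real m * E x) ^ 3) + of_real c * E x)"
      unfolding f_def by (simp add: norm_mult)
    also have "\<dots> \<le> norm (of_real A * exp (of_real m * E x) * (of_real m * E x + 3 * (of_real m * E x)\<^sup>2 + (of_real m * E x) ^ 3)) + norm (of_real c * E x)"
      by (rule norm_triangle_ineq)
    also have "\<dots> \<le> K"
      unfolding K_def using nn nE ne p by (auto simp: norm_mult intro!: add_mono mult_mono)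
    finally show ?thesis .
  qed
  \<comment> \<open>This form of the remainder carries \<open>fact 2\<close> rather than
    \<open>fact 3\<close>, hence \<open>K / 2\<close>.\<close>
  have "norm (f 0 (of_real t) - (\<Sum>i\<le>2. f i 0 * (of_real t - 0) ^ i / fact i)) \<le> K * norm (of_real t - 0 :: complex) ^ Suc 2 / fact 2"
    by (rule field_Taylor[where S = "\<real>"]) (use d B in \<open>auto simp: convex_Reals\<close>)
  moreover have E0: "E 0 = of_real r" by (simp add: E_def)
  have "f 0 0 = 0" "f 1 0 = 0" "f 2 0 = - of_real b"
    by (simp_all add: f_def E0 n b_def exp_of_real[symmetric] algebra_simps power2_eq_square)
  then have "(\<Sum>i\<le>2. f i 0 * (of_real t - 0) ^ i / fact i) = - of_real (b * t\<^sup>2 / 2)"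
    by (simp add: eval_nat_numeral)
  moreover have "E (of_real t) = z" by (simp add: E_def z_def cis_conv_exp)
  then have "f 0 (of_real t) = of_real A * (exp (of_real m * z) - of_real (exp (m * r))) + of_real c * (z - of_real r)
      - \<i> * of_real (n * t)"
    by (simp add: f_def)
  ultimately show ?thesis by (simp add: eval_nat_numeral)
qed

text \<open>Here \<open>b = n\<close>, \<open>K = n/2\<close>, the decay rate is
  \<open>n/12\<close>, and \<open>\<epsilon> = 0\<close> because the decay is quadratic on the whole
  circle. A rate is required, since it enters the relative error of the theorem.\<close>

lemma stirling_rate:
  assumes n: "n > 0"
  shows "\<bar>sqrt (2 * pi * real n) * real n ^ n * exp (- real n) / fact n - 1\<bar> \<le> 216 / sqrt (real n)"
proof -
  define F where "F t = of_real (real n) * cis t - of_real (real n) - \<i> * of_real (real n * t)" for t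
  have F: "norm (F t + of_real (real n * t\<^sup>2 / 2)) \<le> real n / 2 * \<bar>t\<bar> ^ 3" for t
    using exponential_cubic_bound[of 0 0 1 "real n" "real n" t] by (simp add: F_def)
  have decay: "exp (Re (F t)) \<le> exp (- (real n / 12 * t\<^sup>2)) + 0" if "\<bar>t\<bar> \<le> pi" for t
  proof -
    have "real n * (t\<^sup>2 / 12) \<le> real n * (1 - cos t)"
      using one_minus_cos_ge[OF that] by (intro mult_left_mono) auto
    then show ?thesis by (simp add: F_def algebra_simps)
  qed
  have "norm (integral {-pi..pi} (\<lambda>t. exp (F t)) - of_real (sqrt (2 * pi / real n))) \<le>
      (real n / 2 + 1) / (real n / 12)\<^sup>2 + 2 * pi ^ 4 * (real n / 2) * 0"
    by (rule saddle_point_estimate) (use F decay n in \<open>auto simp: F_def intro!: continuous_intros\<close>)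
  \<comment> \<open>\<open>n/2 + 1 <= (3/2) n\<close> and \<open>(3/2) * 12^2 = 216\<close>.\<close>
  also have "\<dots> \<le> 216 / real n"
  proof -
    have "real n \<ge> 1" using n by simp
    then have "(real n / 2 + 1) \<le> 3 / 2 * real n" by simp
    then have "(real n / 2 + 1) / (real n / 12)\<^sup>2 \<le> (3 / 2 * real n) / (real n / 12)\<^sup>2"
      by (intro divide_right_mono) auto
    also have "\<dots> = 216 / real n" using n by (simp add: power2_eq_square field_simps)
    finally show ?thesis by simp
  qed
  finally have est: "norm (integral {-pi..pi} (\<lambda>t. exp (F t)) - of_real (sqrt (2 * pi / real n))) \<le> 216 / real n" .
  have "(deriv ^^ n) exp (0::complex) = 1"
  proof -
    have "deriv exp = (exp :: complex \<Rightarrow> complex)" by (auto intro!: DERIV_imp_deriv derivative_eq_intros)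
    then have "(deriv ^^ n) exp = (exp :: complex \<Rightarrow> complex)" by (induction n) auto
    then show ?thesis by simp
  qed
  then have "((\<lambda>t. exp (of_real (real n) * cis t) * cis (- (real n * t))) has_integral
     of_real (2 * pi * real n ^ n / fact n)) {-pi..pi}"
    using has_integral_circle_coefficient[of exp "real n" n] n by (simp add: holomorphic_on_exp)
  from has_integral_mult_left[OF this, of "exp (- of_real (real n))"]
  have "((\<lambda>t. exp (F t)) has_integral of_real (2 * pi * real n ^ n / fact n) * exp (- of_real (real n))) {-pi..pi}"
    by (simp add: F_def cis_conv_exp mult_exp_exp algebra_simps)
  then have "integral {-pi..pi} (\<lambda>t. exp (F t)) = of_real (2 * pi * real n ^ n / fact n * exp (- real n))"
    by (simp add: integral_unique exp_of_real[symmetric])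
  then have *: "\<bar>2 * pi * real n ^ n / fact n * exp (- real n) - sqrt (2 * pi / real n)\<bar> \<le> 216 / real n"
    using est by (simp only: of_real_diff[symmetric] norm_of_real)
  have s: "sqrt (2 * pi / real n) * sqrt (real n / (2 * pi)) = 1"
    using n by (simp flip: real_sqrt_mult)
  have s2: "2 * pi * sqrt (real n / (2 * pi)) = sqrt (2 * pi * n)"
    using n by (simp add: real_sqrt_divide real_sqrt_mult field_simps)
  have "\<bar>sqrt (2 * pi * real n) * real n ^ n * exp (- real n) / fact n - 1\<bar> =
     \<bar>(2 * pi * real n ^ n / fact n * exp (- real n) - sqrt (2 * pi / real n)) * sqrt (real n / (2 * pi))\<bar>"
    unfolding left_diff_distrib s s2[symmetric] by (simp add: field_simps)
  also have "\<dots> \<le> 216 / real n * sqrt (real n / (2 * pi))"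
    unfolding abs_mult using * by (intro mult_mono) auto
  also have "\<dots> \<le> 216 / real n * sqrt (real n)"
    using n pi_gt3 by (intro mult_left_mono real_sqrt_le_mono) (auto simp: field_simps)
  also have "\<dots> = 216 / sqrt (real n)" using n by (simp add: real_div_sqrt field_simps)
  finally show ?thesis .
qed

section \<open>The saddle point of the generating function\<close>

lemma exp_minus_le_inverse:
  fixes x :: real
  assumes "x \<ge> 0"
  shows "exp (- x) \<le> 1 / (1 + x)"
  using exp_ge_add_one_self[of x] assms by (simp add: exp_minus divide_simps)

lemma egf_saddle_point:
  fixes c m n :: nat and r :: real
  assumes m: "m > 0" and r: "r > 0" and n: "r * (exp (real m * r) + real c) = real n"
  defines "e \<equiv> exp (real m * r)"
  defines "b \<equiv> real n + real m * r\<^sup>2 * e"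
  defines "K \<equiv> (e * (real m * r + 3 * (real m * r)\<^sup>2 + (real m * r) ^ 3) / real m + real c * r) / 2"
  shows "\<bar>2 * pi * r ^ n * real (T c m n) / (fact n * exp ((e - 1) / real m + real c * r)) - sqrt (2 * pi / b)\<bar>
    \<le> (K + 1) / (r * e / 24)\<^sup>2 + 2 * pi ^ 4 * K * exp (- (e / (2 * real m)))"
proof -
  define F where "F t = of_real (1 / real m) * (exp (of_real (real m) * (of_real r * cis t)) - of_real e)
      + of_real (real c) * (of_real r * cis t - of_real r) - \<i> * of_real (real n * t)" for t
  have e: "e > 0" by (simp add: e_def)
  have rn: "real n = r * e + real c * r" using n by (simp add: e_def algebra_simps)
  have F: "norm (F t + of_real (b * t\<^sup>2 / 2)) \<le> K * \<bar>t\<bar> ^ 3" for t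
  proof -
    have bb: "b = real n + 1 / real m * (real m)\<^sup>2 * r\<^sup>2 * exp (real m * r)"
      using m by (simp add: b_def e_def power2_eq_square)
    have KK: "K = (1 / real m * exp (real m * r) * (real m * r + 3 * (real m * r)\<^sup>2 + (real m * r) ^ 3) + real c * r) / 2"
      by (simp add: K_def e_def)
    show ?thesis
      unfolding F_def bb KK e_def
      by (rule exponential_cubic_bound) (use m r n in \<open>auto simp: algebra_simps\<close>)
  qed
  \<comment> \<open>For large \<open>r\<close> a parabola of rate of order \<open>r * e\<close>
    cannot bound \<open>Re (F t)\<close> around the circle, since \<open>Re (F t)\<close> stays of
    order \<open>e\<close>. Where it fails, \<open>Re (F t)\<close> is at most
    \<open>- e / (2 * m)\<close>, so \<open>\<epsilon>\<close> is doubly exponentially small in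
    \<open>r\<close>.\<close>
  have decay: "exp (Re (F t)) \<le> exp (- (r * e / 24 * t\<^sup>2)) + exp (- (e / (2 * real m)))" if t: "\<bar>t\<bar> \<le> pi" for t
  proof -
    \<comment> \<open>The inner exponential has modulus \<open>e * exp (- x)\<close>. The threshold
      1 separates the bounds \<open>x / 2\<close> and \<open>1 / 2\<close> for
      \<open>1 - exp (- x)\<close>.\<close>
    define x where "x = real m * r * (1 - cos t)"
    have x: "x \<ge> 0" using r by (simp add: x_def)
    have "Re (exp (of_real (real m) * (of_real r * cis t))) \<le> exp (real m * r * cos t)"
      using complex_Re_le_cmod[of "exp (of_real (real m) * (of_real r * cis t))"] by (simp add: mult.assoc)
    also have "\<dots> = e * exp (- x)" unfolding e_def mult_exp_exp by (simp add: x_def algebra_simps)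
    finally have "(Re (exp (of_real (real m) * (of_real r * cis t))) - e) / real m \<le> (e * exp (- x) - e) / real m"
      by (intro divide_right_mono) auto
    moreover have "real c * (r * cos t - r) \<le> 0"
      using r by (intro mult_nonneg_nonpos) (auto simp: mult_le_cancel_left1)
    ultimately have Re: "Re (F t) \<le> - (e / real m * (1 - exp (- x)))"
      by (simp add: F_def diff_divide_distrib algebra_simps)
    show ?thesis
    proof (cases "x \<le> 1")
      case True
      have "1 / (1 + x) \<le> 1 - x / 2"
      proof -
        have "x * x \<le> x * 1" using True x by (intro mult_left_mono) auto
        then show ?thesis using x by (simp add: divide_simps algebra_simps)
      qed
      then have "x / 2 \<le> 1 - exp (- x)" using exp_minus_le_inverse[OF x] by simp
      then have "e / real m * (x / 2) \<le> e / real m * (1 - exp (- x))" using e by (intro mult_left_mono) auto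
      moreover have "e / real m * (x / 2) = r * e / 2 * (1 - cos t)" using m by (simp add: x_def)
      \<comment> \<open>The 2 from \<open>x / 2\<close> and the 12 from
        \<open>one_minus_cos_ge\<close> make the 24.\<close>
      moreover have "r * e / 2 * (t\<^sup>2 / 12) \<le> r * e / 2 * (1 - cos t)"
        using one_minus_cos_ge[OF t] r e by (intro mult_left_mono) auto
      ultimately have "Re (F t) \<le> - (r * e / 24 * t\<^sup>2)" using Re by (simp add: algebra_simps)
      then show ?thesis by (simp add: add_increasing2)
    next
      case False
      have "1 / (1 + x) \<le> 1 / 2" using False by (simp add: divide_simps)
      then have "1 / 2 \<le> 1 - exp (- x)" using exp_minus_le_inverse[OF x] by simp
      then have "e / real m * (1 / 2) \<le> e / real m * (1 - exp (- x))" using e by (intro mult_left_mono) auto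
      then have "Re (F t) \<le> - (e / (2 * real m))" using Re by simp
      then show ?thesis by (simp add: add_increasing)
    qed
  qed
  have "norm (integral {-pi..pi} (\<lambda>t. exp (F t)) - of_real (sqrt (2 * pi / b)))
     \<le> (K + 1) / (r * e / 24)\<^sup>2 + 2 * pi ^ 4 * K * exp (- (e / (2 * real m)))"
  proof (rule saddle_point_estimate[OF _ _ _ _ _ F decay])
    show "continuous_on {-pi..pi} F" unfolding F_def by (intro continuous_intros)
    show "r * e / 24 \<le> b / 2" using r e rn by (simp add: b_def field_simps add_increasing)
    show "K \<ge> 0" using r e by (simp add: K_def)
  qed (use r e in auto)
  moreover have "integral {-pi..pi} (\<lambda>t. exp (F t)) =
      of_real (2 * pi * r ^ n * real (T c m n) / (fact n * exp ((e - 1) / real m + real c * r)))"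
  proof -
    have "egf c m holomorphic_on UNIV"
      using has_field_derivative_egf[OF m, of c] by (auto simp: holomorphic_on_def field_differentiable_def)
    from has_integral_circle_coefficient[OF this r, of n]
    have "((\<lambda>t. egf c m (of_real r * cis t) * cis (- (real n * t))) has_integral
        of_real (2 * pi * r ^ n * real (T c m n) / fact n)) {-pi..pi}"
      by (simp add: higher_deriv_egf_0[OF m])
    \<comment> \<open>Dividing by the value of \<open>egf\<close> at \<open>r\<close> normalizes to
      \<open>F 0 = 0\<close>.\<close>
    from has_integral_mult_left[OF this, of "exp (- of_real ((e - 1) / real m + real c * r))"]
    have "((\<lambda>t. exp (F t)) has_integral of_real (2 * pi * r ^ n * real (T c m n) / fact n) *
        exp (- of_real ((e - 1) / real m + real c * r))) {-pi..pi}"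
    proof (rule has_integral_eq[rotated])
      fix t
      show "egf c m (of_real r * cis t) * cis (- (real n * t)) * exp (- of_real ((e - 1) / real m + real c * r)) = exp (F t)"
        unfolding egf_def cis_conv_exp[of "- (real n * t)"] mult_exp_exp F_def
        by (simp add: diff_divide_distrib algebra_simps)
    qed
    then have "integral {-pi..pi} (\<lambda>t. exp (F t)) = of_real (2 * pi * r ^ n * real (T c m n) / fact n) *
        exp (- of_real ((e - 1) / real m + real c * r))"
      by (rule integral_unique)
    also have "\<dots> = of_real (2 * pi * r ^ n * real (T c m n) / fact n * exp (- ((e - 1) / real m + real c * r)))"
      by (simp only: of_real_mult of_real_minus exp_of_real[symmetric])
    also have "2 * pi * r ^ n * real (T c m n) / fact n * exp (- ((e - 1) / real m + real c * r)) =
        2 * pi * r ^ n * real (T c m n) / (fact n * exp ((e - 1) / real m + real c * r))"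
      unfolding exp_minus by (simp add: divide_inverse)
    finally show ?thesis .
  qed
  ultimately show ?thesis by (simp only: of_real_diff[symmetric] norm_of_real)
qed

section \<open>The saddle radius\<close>

lemma rsol:
  assumes "n > 0"
  shows "rsol c m n > 0" "rsol c m n * (exp (real m * rsol c m n) + real c) = real n"
proof -
  let ?g = "\<lambda>r::real. r * (exp (real m * r) + real c)"
  have mono: "?g x < ?g y" if "0 < x" "x < y" for x y
    using that by (intro mult_less_le_imp_less) (auto simp: add_pos_nonneg mult_left_mono)
  \<comment> \<open>The upper end \<open>n\<close> suffices because the second factor of
    \<open>?g\<close> is at least 1.\<close>
  have "\<exists>r\<ge>0. r \<le> real n \<and> ?g r = real n"
  proof (rule IVT')
    have "real n * 1 \<le> real n * (exp (real m * real n) + real c)"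
      by (intro mult_left_mono add_increasing2) auto
    then show "real n \<le> ?g (real n)" by simp
  qed (auto intro!: continuous_intros)
  then obtain r where r: "r \<ge> 0" "?g r = real n" by blast
  then have "r > 0" using assms by (cases "r = 0") auto
  moreover have "s = r" if "s > 0" "?g s = real n" for s
    using mono[of r s] mono[of s r] that r \<open>r > 0\<close> by (cases r s rule: linorder_cases) auto
  ultimately have "\<exists>!r. r > 0 \<and> ?g r = real n" using r by blast
  from theI'[OF this] show "rsol c m n > 0" "rsol c m n * (exp (real m * rsol c m n) + real c) = real n"
    by (simp_all add: rsol_def)
qed

text \<open>A bounded radius would bound \<open>n = r * (exp (m * r) + c)\<close>. The limit allows
  comparisons in \<open>r\<close> alone to be pulled back to \<open>n\<close>.\<close>

lemma filterlim_rsol: "filterlim (rsol c m) at_top sequentially"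
  unfolding filterlim_at_top
proof
  fix R :: real
  let ?g = "\<lambda>r::real. r * (exp (real m * r) + real c)"
  \<comment> \<open>The absolute value keeps the argument where \<open>?g\<close> is
    increasing.\<close>
  have "eventually (\<lambda>n. real n > ?g \<bar>R\<bar>) sequentially"
    using filterlim_real_sequentially by (simp add: filterlim_at_top_dense)
  then show "eventually (\<lambda>n. rsol c m n \<ge> R) sequentially"
  proof eventually_elim
    case (elim n)
    have "0 \<le> ?g \<bar>R\<bar>" by simp
    then have n: "n > 0" using elim by (metis of_nat_0_less_iff order.strict_trans1)
    show ?case
    proof (rule ccontr)
      assume "\<not> R \<le> rsol c m n"
      then have "rsol c m n \<le> \<bar>R\<bar>" by simp
      then have "?g (rsol c m n) \<le> ?g \<bar>R\<bar>"
        using rsol[OF n, of c m] by (intro mult_mono add_mono) (auto intro!: mult_left_mono add_nonneg_nonneg)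
      then show False using rsol(2)[OF n, of c m] elim by simp
    qed
  qed
qed

section \<open>Arithmetic of relative errors\<close>

lemma one_plus_bigo_mult:
  fixes f g h :: "'a \<Rightarrow> real"
  assumes "(\<lambda>x. f x - 1) \<in> O[F](h)" "(\<lambda>x. g x - 1) \<in> O[F](h)" "(h \<longlongrightarrow> 0) F"
  shows "(\<lambda>x. f x * g x - 1) \<in> O[F](h)"
proof -
  have "h \<in> O[F](\<lambda>_. 1)" using assms(3) by (intro bigoI_tendsto[where c = 0]) auto
  then have "(\<lambda>x. (f x - 1) * (g x - 1)) \<in> O[F](\<lambda>x. h x * 1)"
    by (intro landau_o.big.mult assms(1) landau_o.big_trans[OF assms(2)])
  then have "(\<lambda>x. (f x - 1) * (g x - 1)) \<in> O[F](h)" by simp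
  then have "(\<lambda>x. (f x - 1) * (g x - 1) + (f x - 1) + (g x - 1)) \<in> O[F](h)"
    by (intro sum_in_bigo(1)[OF sum_in_bigo(1)] assms(1,2))
  then show ?thesis by (simp add: algebra_simps)
qed

text \<open>Once \<open>f > 1/2\<close>, inversion at most doubles the distance from 1.\<close>

lemma one_plus_bigo_inverse:
  fixes f h :: "'a \<Rightarrow> real"
  assumes "(\<lambda>x. f x - 1) \<in> O[F](h)" "(h \<longlongrightarrow> 0) F"
  shows "(\<lambda>x. inverse (f x) - 1) \<in> O[F](h)"
proof -
  have "((\<lambda>x. f x - 1) \<longlongrightarrow> 0) F"
    using landau_o.big_small_trans[OF assms(1) smalloI_tendsto[of h "\<lambda>_. 1"]] assms(2)
    by (auto dest: smalloD_tendsto)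
  then have "eventually (\<lambda>x. \<bar>f x - 1\<bar> < 1 / 2) F"
    by (rule order_tendstoD(2)[OF tendsto_rabs_zero]) simp
  then have "eventually (\<lambda>x. norm (inverse (f x) - 1) \<le> 2 * norm (f x - 1)) F"
  proof eventually_elim
    case (elim x)
    then have "f x > 1 / 2" by linarith
    then have "inverse (f x) - 1 = (1 - f x) * inverse (f x)" "\<bar>inverse (f x)\<bar> \<le> 2"
      by (auto simp: field_simps)
    then show ?case using mult_left_mono[of "\<bar>inverse (f x)\<bar>" 2 "\<bar>f x - 1\<bar>"]
      by (simp add: abs_mult abs_minus_commute mult.commute)
  qed
  then have "(\<lambda>x. inverse (f x) - 1) \<in> O[F](\<lambda>x. f x - 1)" by (rule bigoI)
  then show ?thesis using assms(1) by (rule landau_o.big_trans)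
qed

section \<open>Asymptotics\<close>

text \<open>With \<open>n = r * (exp (m * r) + c)\<close> one has
  \<open>n * (m r + 1) = b + m c r^2\<close>, so the quotient is \<open>1 + u\<close> with
  \<open>u\<close> of order \<open>exp (- m r)\<close>. Trading \<open>b\<close> for
  \<open>n * (m r + 1)\<close> produces the \<open>sqrt (m r + 1)\<close> of the theorem.\<close>

lemma sqrt_quotient_bigo:
  fixes m c :: real
  assumes "m > 0" "c > 0"
  shows "(\<lambda>r. sqrt (r * (exp (m * r) + c) * (m * r + 1) / (r * (exp (m * r) + c) + m * r\<^sup>2 * exp (m * r))) - 1)
    \<in> O(\<lambda>r. r ^ 3 * exp (- (m * r / 2)))"
proof -
  have "\<bar>sqrt (r * (exp (m * r) + c) * (m * r + 1) / (r * (exp (m * r) + c) + m * r\<^sup>2 * exp (m * r))) - 1\<bar>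
     \<le> 1 * \<bar>m * c * r\<^sup>2 / (r * (exp (m * r) + c) + m * r\<^sup>2 * exp (m * r))\<bar>" if r: "r > 0" for r
  proof -
    define b where "b = r * (exp (m * r) + c) + m * r\<^sup>2 * exp (m * r)"
    define u where "u = m * c * r\<^sup>2 / b"
    have b: "b > 0" unfolding b_def using r assms by (intro add_pos_pos mult_pos_pos) auto
    have u: "u \<ge> 0" using r assms b by (simp add: u_def)
    have "r * (exp (m * r) + c) * (m * r + 1) = b + m * c * r\<^sup>2"
      by (simp add: b_def algebra_simps power2_eq_square)
    then have "r * (exp (m * r) + c) * (m * r + 1) / b = 1 + u"
      using b by (simp add: u_def add_divide_distrib)
    moreover have "sqrt (1 + u) \<le> 1 + u" using u by (intro real_le_lsqrt) (auto simp: power2_eq_square algebra_simps)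
    moreover have "sqrt (1 + u) \<ge> 1" using u by simp
    ultimately show ?thesis using u unfolding b_def[symmetric] u_def[symmetric] by simp
  qed
  then have "(\<lambda>r. sqrt (r * (exp (m * r) + c) * (m * r + 1) / (r * (exp (m * r) + c) + m * r\<^sup>2 * exp (m * r))) - 1)
    \<in> O(\<lambda>r. m * c * r\<^sup>2 / (r * (exp (m * r) + c) + m * r\<^sup>2 * exp (m * r)))"
    by (intro bigoI[of _ 1] eventually_mono[OF eventually_gt_at_top[of 0]]) simp
  also have "(\<lambda>r. m * c * r\<^sup>2 / (r * (exp (m * r) + c) + m * r\<^sup>2 * exp (m * r))) \<in> O(\<lambda>r. r ^ 3 * exp (- (m * r / 2)))"
    using assms by real_asymp
  finally show ?thesis .
qed

text \<open>The bound of \<open>egf_saddle_point\<close> relative to its main term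
  \<open>sqrt (2 * pi / b)\<close>, with \<open>n\<close> expressed through
  \<open>r\<close>.\<close>

lemma saddle_point_error_bigo:
  fixes m c :: real
  assumes "m > 0" "c > 0"
  shows "(\<lambda>r. sqrt ((r * (exp (m * r) + c) + m * r\<^sup>2 * exp (m * r)) / (2 * pi)) *
      (((exp (m * r) * (m * r + 3 * (m * r)\<^sup>2 + (m * r) ^ 3) / m + c * r) / 2 + 1) / (r * exp (m * r) / 24)\<^sup>2 +
        2 * pi ^ 4 * ((exp (m * r) * (m * r + 3 * (m * r)\<^sup>2 + (m * r) ^ 3) / m + c * r) / 2) *
          exp (- (exp (m * r) / (2 * m)))))
    \<in> O(\<lambda>r. r ^ 3 * exp (- (m * r / 2)))"
  using assms by real_asymp

theorem theorem4:
  fixes m c :: nat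
  assumes "m > 0" and "c > 0"
  shows "(\<lambda>n. real (T c m n) /
            (1 / sqrt (real m * rsol c m n + 1) *
             exp (real m * real n * rsol c m n - real n + real n / (real m * rsol c m n)
                  + 2 * real c * rsol c m n - (1 + real c) / real m)) - 1)
         \<in> O(\<lambda>n. ln (real n) powr (7/2) / sqrt (real n))"
proof -
  have mc: "real m > 0" "real c > 0" using assms by auto
  define R where "R = rsol c m"
  define h where "h r = r ^ 3 * exp (- (real m * r / 2))" for r
  define N where "N r = r * (exp (real m * r) + real c)" for r
  define b where "b r = N r + real m * r\<^sup>2 * exp (real m * r)" for r
  define K where "K r = (exp (real m * r) * (real m * r + 3 * (real m * r)\<^sup>2 + (real m * r) ^ 3) / real m + real c * r) / 2" for r
  \<comment> \<open>Four factors tending to 1: \<open>X\<close> is the Cauchy integral over its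
    Gaussian value, \<open>Y\<close> the Stirling quotient, \<open>Z\<close> trades \<open>b\<close>
    for \<open>n * (m r + 1)\<close>, and \<open>W\<close> trades \<open>(e + c)^n\<close> for
    \<open>exp (m r n + c r)\<close>.\<close>
  define X where "X n = sqrt (b (R n) / (2 * pi)) * (2 * pi * R n ^ n * real (T c m n) /
      (fact n * exp ((exp (real m * R n) - 1) / real m + real c * R n)))" for n
  define Y where "Y n = sqrt (2 * pi * real n) * real n ^ n * exp (- real n) / fact n" for n :: nat
  define Z where "Z r = sqrt (N r * (real m * r + 1) / b r)" for r
  define W where "W r = exp (N r * ln (exp (real m * r) + real c) - real m * r * N r - real c * r)" for r
  have R: "R n > 0" "N (R n) = real n" if "n > 0" for n
    using rsol[OF that, of c m] by (auto simp: R_def N_def)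
  have lim: "filterlim R at_top sequentially" unfolding R_def by (rule filterlim_rsol)
  have ev: "eventually (\<lambda>n::nat. n > 0) sequentially" by (rule eventually_gt_at_top)
  have h0: "((\<lambda>n. h (R n)) \<longlongrightarrow> 0) sequentially"
  proof -
    have "(h \<longlongrightarrow> 0) at_top" unfolding h_def using mc by real_asymp
    then show ?thesis using lim by (rule filterlim_compose)
  qed
  have "(\<lambda>n. X n - 1) \<in> O(\<lambda>n. h (R n))"
  proof -
    define E where "E r = sqrt (b r / (2 * pi)) *
      ((K r + 1) / (r * exp (real m * r) / 24)\<^sup>2 + 2 * pi ^ 4 * K r * exp (- (exp (real m * r) / (2 * real m))))" for r
    have "norm (X n - 1) \<le> 1 * norm (E (R n))" if n: "n > 0" for n
    proof -
      define A where "A = 2 * pi * R n ^ n * real (T c m n) /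
        (fact n * exp ((exp (real m * R n) - 1) / real m + real c * R n))"
      have b: "b (R n) > 0" unfolding b_def using R[OF n] n mc by (intro add_pos_nonneg) auto
      have "sqrt (b (R n) / (2 * pi)) * sqrt (2 * pi / b (R n)) = 1"
        using b by (simp flip: real_sqrt_mult)
      then have "X n - 1 = sqrt (b (R n) / (2 * pi)) * (A - sqrt (2 * pi / b (R n)))"
        by (simp add: X_def A_def right_diff_distrib)
      also have "\<bar>\<dots>\<bar> = sqrt (b (R n) / (2 * pi)) * \<bar>A - sqrt (2 * pi / b (R n))\<bar>"
        using b by (simp add: abs_mult)
      also have "\<dots> \<le> E (R n)"
        unfolding E_def
      proof (rule mult_left_mono)
        show "\<bar>A - sqrt (2 * pi / b (R n))\<bar> \<le> (K (R n) + 1) / (R n * exp (real m * R n) / 24)\<^sup>2 +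
            2 * pi ^ 4 * K (R n) * exp (- (exp (real m * R n) / (2 * real m)))"
          unfolding A_def b_def K_def R(2)[OF n]
          by (rule egf_saddle_point[OF assms(1) R(1)[OF n] R(2)[OF n, unfolded N_def]])
      qed (use b in simp)
      finally show ?thesis by simp
    qed
    then have "(\<lambda>n. X n - 1) \<in> O(\<lambda>n. E (R n))"
      by (intro bigoI[of _ 1] eventually_mono[OF ev])
    also have "(\<lambda>n. E (R n)) \<in> O(\<lambda>n. h (R n))"
    proof (rule landau_o.big.compose[OF _ lim])
      show "E \<in> O(h)" unfolding E_def h_def b_def N_def K_def by (rule saddle_point_error_bigo[OF mc])
    qed
    finally show ?thesis .
  qed
  moreover have "(\<lambda>n. Y n - 1) \<in> O(\<lambda>n. h (R n))"
  proof -
    have "(\<lambda>n. Y n - 1) \<in> O(\<lambda>n. 1 / sqrt (N (R n)))"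
      using stirling_rate R by (intro bigoI[of _ 216] eventually_mono[OF ev]) (auto simp: Y_def)
    also have "(\<lambda>n. 1 / sqrt (N (R n))) \<in> O(\<lambda>n. h (R n))"
    proof (rule landau_o.big.compose[OF _ lim])
      show "(\<lambda>r. 1 / sqrt (N r)) \<in> O(h)" unfolding h_def N_def using mc by real_asymp
    qed
    finally show ?thesis .
  qed
  moreover have "(\<lambda>n. Z (R n) - 1) \<in> O(\<lambda>n. h (R n))"
  proof (rule landau_o.big.compose[OF _ lim])
    show "(\<lambda>r. Z r - 1) \<in> O(h)"
      unfolding h_def Z_def b_def N_def using sqrt_quotient_bigo[OF mc] by simp
  qed
  moreover have "(\<lambda>n. W (R n) - 1) \<in> O(\<lambda>n. h (R n))"
  proof (rule landau_o.big.compose[OF _ lim])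
    \<comment> \<open>\<open>N r * ln (1 + c / e) = c r + O(r / e)\<close> with
      \<open>e = exp (m r)\<close>; the term \<open>c r\<close> is subtracted in
      \<open>W\<close>.\<close>
    show "(\<lambda>r. W r - 1) \<in> O(h)" unfolding h_def W_def N_def using mc by real_asymp
  qed
  ultimately have "(\<lambda>n. X n * Z (R n) * W (R n) * inverse (Y n) - 1) \<in> O(\<lambda>n. h (R n))"
    by (intro one_plus_bigo_mult one_plus_bigo_inverse h0)
  also have "(\<lambda>n. h (R n)) \<in> O(\<lambda>n. ln (N (R n)) powr (7/2) / sqrt (N (R n)))"
  proof (rule landau_o.big.compose[OF _ lim])
    show "h \<in> O(\<lambda>r. ln (N r) powr (7/2) / sqrt (N r))"
      unfolding h_def N_def using mc by real_asymp
  qed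
  also have "O(\<lambda>n. ln (N (R n)) powr (7/2) / sqrt (N (R n))) = O(\<lambda>n. ln (real n) powr (7/2) / sqrt (real n))"
    by (intro landau_o.big.cong eventually_mono[OF ev]) (simp add: R)
  \<comment> \<open>No further error enters: for \<open>n > 0\<close> the product equals the
    quotient in the theorem exactly.\<close>
  also have "(\<lambda>n. X n * Z (R n) * W (R n) * inverse (Y n) - 1) \<in> O(\<lambda>n. ln (real n) powr (7/2) / sqrt (real n)) \<longleftrightarrow>
    ?thesis"
  proof (rule landau_o.big.in_cong, rule eventually_mono[OF ev])
    fix n :: nat assume n: "n > 0"
    define r e where "r = R n" and "e = exp (real m * r)"
    have r: "r > 0" and Nr: "N r = real n" and re: "real n = r * (e + real c)"
      using R[OF n] by (auto simp: r_def e_def N_def)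
    have e: "e > 0" by (simp add: e_def)
    have b: "b r > 0" unfolding b_def Nr using n mc by (intro add_pos_nonneg) auto
    have bracket: "sqrt (b r / (2 * pi)) * (2 * pi) * Z r * inverse (sqrt (2 * pi * real n)) = sqrt (real m * r + 1)"
    proof -
      have "sqrt (b r / (2 * pi)) * (2 * pi) * Z r * inverse (sqrt (2 * pi * real n)) =
        sqrt (b r / (2 * pi) * (2 * pi)\<^sup>2 * (real n * (real m * r + 1) / b r) * inverse (2 * pi * real n))"
      proof -
        have "sqrt ((2 * pi)\<^sup>2) = 2 * pi" by (intro real_sqrt_unique) auto
        then show ?thesis by (simp only: Z_def Nr real_sqrt_mult real_sqrt_inverse)
      qed
      also have "b r / (2 * pi) * (2 * pi)\<^sup>2 * (real n * (real m * r + 1) / b r) * inverse (2 * pi * real n) = real m * r + 1"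
        using b n by (simp add: field_simps power2_eq_square)
      finally show ?thesis .
    qed
    have pow: "r ^ n * inverse (real n ^ n) = exp (- (real n * ln (e + real c)))"
    proof -
      have "(e + real c) ^ n = exp (real n * ln (e + real c))"
        using e by (simp add: exp_of_nat_mult add_pos_nonneg)
      then have "real n ^ n = r ^ n * exp (real n * ln (e + real c))"
        using arg_cong[where f = "\<lambda>x. x ^ n", OF re] by (metis power_mult_distrib)
      then have "r ^ n * inverse (real n ^ n) = r ^ n * (inverse (r ^ n) * inverse (exp (real n * ln (e + real c))))"
        by (simp only: inverse_mult_distrib)
      also have "\<dots> = inverse (exp (real n * ln (e + real c)))"
        using r by (simp flip: mult.assoc)
      finally show ?thesis unfolding exp_minus .
    qed
    have nmr: "real n / (real m * r) = (e + real c) / real m" using r unfolding re by simp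
    \<comment> \<open>Regrouping of opaque reals, in which \<open>f = fact n\<close> cancels between
      \<open>X\<close> and \<open>Y\<close>.\<close>
    have rearrange: "s * (p * q * t / (f * g)) * z * w * inverse (k * l * v / f) =
      t * (s * p * z * inverse k) * (q * inverse l) * w * inverse g * inverse v" if "f \<noteq> 0"
      for s p q t f g z w k l v :: real
      using that by (simp add: divide_inverse)
    have exps: "t * s * exp (- a) * exp u * inverse (exp d) * inverse (exp (- v)) =
      t * s * exp (- a + u - d + v)" for t s a u d v :: real
      by (simp add: exp_add exp_diff exp_minus divide_inverse)
    have "X n * Z (R n) * W (R n) * inverse (Y n) =
      real (T c m n) * (sqrt (b r / (2 * pi)) * (2 * pi) * Z r * inverse (sqrt (2 * pi * real n))) *
      (r ^ n * inverse (real n ^ n)) * W r * inverse (exp ((e - 1) / real m + real c * r)) * inverse (exp (- real n))"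
      unfolding X_def Y_def r_def[symmetric] e_def[symmetric] by (rule rearrange) simp
    also have "\<dots> = real (T c m n) * sqrt (real m * r + 1) *
      exp (- (real n * ln (e + real c)) + (real n * ln (e + real c) - real m * r * real n - real c * r)
        - ((e - 1) / real m + real c * r) + real n)"
      unfolding bracket pow W_def Nr e_def[symmetric] by (rule exps)
    \<comment> \<open>The two \<open>c * r\<close>, one from \<open>W\<close> and one from
      \<open>egf\<close>, add up to \<open>2 * c * r\<close>; \<open>nmr\<close> turns
      \<open>(e - 1) / m\<close> into \<open>n / (m r) - (1 + c) / m\<close>.\<close>
    also have "- (real n * ln (e + real c)) + (real n * ln (e + real c) - real m * r * real n - real c * r)
        - ((e - 1) / real m + real c * r) + real n =
      - (real m * real n * r - real n + real n / (real m * r) + 2 * real c * r - (1 + real c) / real m)"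
      unfolding nmr by (simp add: diff_divide_distrib add_divide_distrib algebra_simps)
    finally show "X n * Z (R n) * W (R n) * inverse (Y n) - 1 = real (T c m n) /
            (1 / sqrt (real m * rsol c m n + 1) *
             exp (real m * real n * rsol c m n - real n + real n / (real m * rsol c m n)
                  + 2 * real c * rsol c m n - (1 + real c) / real m)) - 1"
      unfolding R_def[symmetric] r_def[symmetric] exp_minus by (simp add: divide_inverse mult.assoc)
  qed
  finally show ?thesis .
qed

end
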